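(* Let $n\ge 2$ be an integer. The eigenvalues of the Laplacian matrix of $G_n$, listed with multiplicity, are $$0,\qquad 1,\qquad n\ \text{ with multiplicity } n-2,\qquad n+1.$$ In particular, $\lambda_2(G_n)=1$ and $$\gamma(G_n)=\frac{|E(G_n)|}{\lambda_2(G_n)}=\binom{n}{2}+1.$$
   Context: For $n\ge 2$, $G_n$ is the simple graph on $n+1$ vertices obtained from the complete graph $K_n$ by adding one new vertex $\ell$ (the leaf) joined by a single edge to one fixed vertex of $K_n$. The Laplacian matrix of a graph $G$ is $L=D-A$, where $D$ is the diagonal degree matrix and $A$ the adjacency matrix. $\lambda_2(G)$ denotes the second-smallest eigenvalue of $L$ (counted with multiplicity), and for connected $G=(V,E)$, $\gamma(G)=|E|/\lambda_2(G)$. *)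

theory Defs
  imports
    "Jordan_Normal_Form.Char_Poly"
    "HOL-Library.Multiset"
begin

text \<open>A graph is a pair of a vertex set and a set of edges, an edge being the two-element
  set of its endpoints.\<close>

type_synonym 'a ugraph = "'a set \<times> 'a set set"

definition simple_graph :: "'a ugraph \<Rightarrow> bool" where
  "simple_graph G \<longleftrightarrow> finite (fst G) \<and> (\<forall>e\<in>snd G. e \<subseteq> fst G \<and> card e = 2)"

definition complete_graph :: "'a set \<Rightarrow> 'a ugraph" where
  "complete_graph V = (V, {e. e \<subseteq> V \<and> card e = 2})"

definition add_leaf :: "'a \<Rightarrow> 'a \<Rightarrow> 'a ugraph \<Rightarrow> 'a ugraph" where
  "add_leaf l v G = (insert l (fst G), insert {l, v} (snd G))"

text \<open>The complete graph has vertices \<open>0, \<dots>, n - 1\<close>, the leaf is the vertex \<open>n\<close>,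
  and \<open>v\<close> is the vertex of the complete graph to which the leaf is attached.\<close>

definition G_graph :: "nat \<Rightarrow> nat \<Rightarrow> nat ugraph" where
  "G_graph n v = add_leaf n v (complete_graph {0..<n})"

text \<open>Matrix rows and columns are indexed by \<open>0, \<dots>, N - 1\<close>, so the matrices below are the
  usual ones only for graphs whose vertex set is \<open>{0..<N}\<close>.\<close>

definition vertex_degree :: "'a ugraph \<Rightarrow> 'a \<Rightarrow> nat" where
  "vertex_degree G u = card {e \<in> snd G. u \<in> e}"

definition degree_mat :: "nat ugraph \<Rightarrow> real mat" where
  "degree_mat G = mat (card (fst G)) (card (fst G))
     (\<lambda>(i, j). if i = j then real (vertex_degree G i) else 0)"

definition adjacency_mat :: "nat ugraph \<Rightarrow> real mat" where
  "adjacency_mat G = mat (card (fst G)) (card (fst G))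
     (\<lambda>(i, j). if {i, j} \<in> snd G then 1 else 0)"

definition laplacian_mat :: "nat ugraph \<Rightarrow> real mat" where
  "laplacian_mat G = degree_mat G - adjacency_mat G"

text \<open>The eigenvalues with their algebraic multiplicities. For the real symmetric Laplacian
  these are also the geometric ones, and all complex eigenvalues are real.\<close>

definition eigenvalue_mset :: "real mat \<Rightarrow> real multiset" where
  "eigenvalue_mset A = proots (char_poly A)"

text \<open>Second-smallest eigenvalue, counted with multiplicity; list positions start at 0.\<close>

definition lambda2 :: "nat ugraph \<Rightarrow> real" where
  "lambda2 G = sorted_list_of_multiset (eigenvalue_mset (laplacian_mat G)) ! 1"

text \<open>Meaningful for connected graphs, where the denominator is positive.\<close>

definition gamma :: "nat ugraph \<Rightarrow> real" where
  "gamma G = real (card (snd G)) / lambda2 G"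

lemma set_mset_eigenvalue_mset:
  assumes "A \<in> carrier_mat m m"
  shows "set_mset (eigenvalue_mset A) = {k. eigenvalue A k}"
proof -
  have "char_poly A \<noteq> 0"
    using degree_monic_char_poly[OF assms] by auto
  then show ?thesis
    by (simp add: eigenvalue_mset_def eigenvalue_root_char_poly[OF assms])
qed

lemma fst_G_graph: "fst (G_graph n v) = {0..<Suc n}"
  by (auto simp: G_graph_def add_leaf_def complete_graph_def)

lemma simple_graph_G_graph:
  assumes "v < n"
  shows "simple_graph (G_graph n v)"
  using assms
  by (auto simp: simple_graph_def G_graph_def add_leaf_def complete_graph_def)

end

theory Submission
  imports Defs
begin

text \<open>Order the vertices as: attachment vertex, leaf, all others. The all-ones vector \<open>c\<^sub>0\<close>, the
  eigenvector \<open>c\<^sub>1 = (0, 1 - n, 1, \<dots>, 1)\<close> for the eigenvalue \<open>1\<close>, the vector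
  \<open>c\<^sub>2 = (0, 0, 1, \<dots>, 1)\<close> and the unit vectors \<open>c\<^sub>j = e\<^sub>j\<close> for \<open>j \<ge> 3\<close> form a lower triangular
  invertible matrix. In this basis the Laplacian is upper triangular with diagonal
  \<open>0, 1, n + 1, n, \<dots>, n\<close>.\<close>

lemma vertex_degree_eq_card_neighbours:
  assumes "simple_graph G"
  shows "vertex_degree G u = card {w. {u, w} \<in> snd G}"
proof -
  have "bij_betw (\<lambda>w. {u, w}) {w. {u, w} \<in> snd G} {e \<in> snd G. u \<in> e}"
  proof (rule bij_betwI')
    fix x y
    show "({u, x} = {u, y}) \<longleftrightarrow> x = y"
      by (metis doubleton_eq_iff)
  next
    fix e assume e: "e \<in> {e \<in> snd G. u \<in> e}"
    with assms have "card e = 2" by (auto simp: simple_graph_def)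
    with e obtain w where "e = {u, w}"
      by (auto simp: card_2_iff)
    with e show "\<exists>x\<in>{w. {u, w} \<in> snd G}. e = {u, x}" by auto
  qed auto
  then show ?thesis
    by (simp add: vertex_degree_def bij_betw_same_card)
qed

lemma laplacian_mat_carrier:
  assumes "fst G = {0..<N}"
  shows "laplacian_mat G \<in> carrier_mat N N"
  using assms by (simp add: laplacian_mat_def degree_mat_def adjacency_mat_def minus_carrier_mat)

text \<open>The degree of \<open>i\<close> is its number of neighbours, so the diagonal term can be
  distributed over them. Only differences along edges remain, computed column by column.\<close>

lemma laplacian_mat_mult_index:
  assumes G: "simple_graph G" and V: "fst G = {0..<N}"
    and A: "A \<in> carrier_mat N m" and "i < N" "j < m"
  shows "(laplacian_mat G * A) $$ (i, j) = (\<Sum>k | {i, k} \<in> snd G. A $$ (i, j) - A $$ (k, j))"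
proof -
  let ?S = "{k. {i, k} \<in> snd G}"
  have sub: "?S \<subseteq> {0..<N}" using G V by (auto simp: simple_graph_def)
  then have fin: "finite ?S" using finite_subset by blast
  have "(laplacian_mat G * A) $$ (i, j) =
      (\<Sum>k\<in>{0..<N}. (if k = i then real (vertex_degree G i) * A $$ (k, j) else 0) -
                   (if {i, k} \<in> snd G then A $$ (k, j) else 0))"
    using assms
    by (auto simp: laplacian_mat_def degree_mat_def adjacency_mat_def scalar_prod_def
        algebra_simps intro!: sum.cong)
  also have "\<dots> = real (card ?S) * A $$ (i, j) - (\<Sum>k\<in>?S. A $$ (k, j))"
  proof -
    have "(\<Sum>k\<in>{0..<N}. if {i, k} \<in> snd G then A $$ (k, j) else 0) = (\<Sum>k\<in>?S. A $$ (k, j))"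
      using sub by (intro sum.mono_neutral_cong_right) auto
    then show ?thesis
      using \<open>i < N\<close> by (simp add: sum_subtractf vertex_degree_eq_card_neighbours[OF G])
  qed
  finally show ?thesis by (simp add: sum_subtractf)
qed

text \<open>Multiplying by the inverse of \<open>P\<close> on the right gives the similarity. Thus
  an eigenbasis argument reduces to one product identity, checked entrywise, and no inverse is ever
  computed.\<close>

lemma similar_mat_of_intertwining:
  fixes A B P :: "'a :: field mat"
  assumes A: "A \<in> carrier_mat n n" and B: "B \<in> carrier_mat n n" and P: "P \<in> carrier_mat n n"
    and det: "det P \<noteq> 0" and eq: "A * P = P * B"
  shows "similar_mat A B"
proof -
  \<comment> \<open>\<open>undefined\<close> fills the extension slot of the record
    \<open>ring_mat\<close>; a unit of this ring is a matrix with a two-sided inverse.\<close>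
  from det_non_zero_imp_unit[OF P det, of undefined] obtain Q
    where Q: "Q \<in> carrier_mat n n" and QP: "Q * P = 1\<^sub>m n" and PQ: "P * Q = 1\<^sub>m n"
    by (auto simp: Units_def ring_mat_def)
  have "A = A * (P * Q)" using A PQ by simp
  also have "\<dots> = P * B * Q" using A P Q eq by (simp flip: assoc_mult_mat)
  finally show ?thesis
    using A B P Q PQ QP by (intro similar_matI[of _ _ P Q n]) auto
qed

lemma proots_prod_list_linear:
  fixes xs :: "'a :: idom list"
  shows "proots (\<Prod>a\<leftarrow>xs. [:- a, 1:]) = mset xs"
proof (induction xs)
  case (Cons a xs)
  have "(\<Prod>a\<leftarrow>xs. [:- a, 1:]) \<noteq> 0" by (auto simp: prod_list_zero_iff)
  then have "proots ([:- a, 1:] * (\<Prod>a\<leftarrow>xs. [:- a, 1:])) = {#a#} + mset xs"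
    by (subst proots_mult) (auto simp: Cons.IH)
  then show ?case by simp
qed simp

text \<open>Similarity preserves the characteristic polynomial, and for a triangular matrix it
  splits into linear factors with the diagonal entries as roots.\<close>

lemma eigenvalue_mset_similar_upper_triangular:
  assumes "similar_mat A T" "T \<in> carrier_mat n n" "upper_triangular T"
  shows "eigenvalue_mset A = mset (diag_mat T)"
  by (simp add: eigenvalue_mset_def char_poly_similar[OF assms(1)]
      char_poly_upper_triangular[OF assms(2,3)] proots_prod_list_linear)

lemma edge_G_graph_iff:
  assumes "v < n"
  shows "{i, j} \<in> snd (G_graph n v) \<longleftrightarrow>
    (i \<noteq> j \<and> i < n \<and> j < n) \<or> (i = n \<and> j = v) \<or> (i = v \<and> j = n)"
  using assms
  by (auto simp: G_graph_def add_leaf_def complete_graph_def doubleton_eq_iff card_2_iff)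

lemma card_edges_G_graph: "card (snd (G_graph n v)) = (n choose 2) + 1"
proof -
  have "finite {e. e \<subseteq> {0..<n} \<and> card e = 2}" by simp
  moreover have "{n, v} \<notin> {e. e \<subseteq> {0..<n} \<and> card e = 2}" by auto
  ultimately show ?thesis
    by (simp add: G_graph_def add_leaf_def complete_graph_def n_subsets)
qed

text \<open>Coordinate \<open>a\<close> of \<open>c\<^sub>j\<close>. The first three columns span
  the vectors constant on the positions \<open>2, ..., n\<close>; the reordered Laplacian preserves
  this span and acts modulo it as multiplication by \<open>n\<close>.\<close>

definition basis_entry :: "nat \<Rightarrow> nat \<Rightarrow> nat \<Rightarrow> real" where
  "basis_entry n a j =
    (if j = 0 then 1
     else if j = 1 then (if a = 0 then 0 else if a = 1 then 1 - real n else 1)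
     else if j = 2 then (if a \<ge> 2 then 1 else 0)
     else (if a = j then 1 else 0))"

text \<open>Column \<open>j\<close> holds the coefficients of the image of \<open>c\<^sub>j\<close>.
  For \<open>j \<ge> 3\<close> the image is \<open>n e\<^sub>j - (1, 0, 1, ..., 1)\<close>. The
  subtracted vector is \<open>c\<^sub>0 - e\<^sub>1\<close>, where
  \<open>e\<^sub>1 = (c\<^sub>2 - c\<^sub>1) / (n - 1)\<close>.\<close>

definition triangular_entry :: "nat \<Rightarrow> nat \<Rightarrow> nat \<Rightarrow> real" where
  "triangular_entry n k j =
    (if j = 0 then 0
     else if j = 1 then (if k = 1 then 1 else 0)
     else if j = 2 then (if k = 0 then 1 - real n else if k = 1 then - 1
                         else if k = 2 then real n + 1 else 0)
     else (if k = 0 then - 1 else if k = 1 then - 1 / (real n - 1)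
           else if k = 2 then 1 / (real n - 1) else if k = j then real n else 0))"

text \<open>The right-hand side is the reordered Laplacian applied to \<open>c\<^sub>j\<close>, at
  position \<open>a\<close>. For \<open>a \<ge> 2\<close> the index set is the neighbourhood
  together with \<open>a\<close> itself, whose term is zero; this keeps the set independent of
  \<open>a\<close>.\<close>

lemma sum_basis_entry_triangular_entry:
  assumes "n \<ge> 2" "a \<le> n" "j \<le> n"
  shows "(\<Sum>k = 0..<Suc n. basis_entry n a k * triangular_entry n k j) =
    (\<Sum>b\<in>(if a = 0 then insert 1 {2..n} else if a = 1 then {0} else insert 0 {2..n}).
       basis_entry n a j - basis_entry n b j)"
proof -
  have "(\<Sum>k = 0..<Suc n. basis_entry n a k * triangular_entry n k j) =
      (\<Sum>k\<in>{0, 1, 2, j}. basis_entry n a k * triangular_entry n k j)"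
    using assms by (intro sum.mono_neutral_right) (auto simp: triangular_entry_def)
  moreover consider "j = 0" | "j = 1" | "j = 2" | "j \<ge> 3" by linarith
  then have "(\<Sum>k\<in>{0, 1, 2, j}. basis_entry n a k * triangular_entry n k j) =
    (\<Sum>b\<in>(if a = 0 then insert 1 {2..n} else if a = 1 then {0} else insert 0 {2..n}).
       basis_entry n a j - basis_entry n b j)"
  proof cases
    case 2
    then have "{0, 1, 2, j} = {0, 1, 2}" by auto
    then show ?thesis
      using 2 assms by (auto simp: basis_entry_def triangular_entry_def of_nat_diff algebra_simps)
  next
    case 4
    have "(\<Sum>b = 2..n. basis_entry n b j) = (\<Sum>b = 2..n. if b = j then 1 else 0)"
      using 4 by (intro sum.cong) (auto simp: basis_entry_def)
    also have "\<dots> = 1" using 4 assms by simp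
    finally have sum_one: "(\<Sum>b = 2..n. basis_entry n b j) = 1" .
    \<comment> \<open>The squared denominator is nonzero; the next line gives this in expanded form,
      for combining the fractions over \<open>n - 1\<close>.\<close>
    have "(real n - 1) * (real n - 1) \<noteq> 0" using assms by simp
    then have "1 + real n * real n \<noteq> real n * 2" by (simp add: algebra_simps)
    with sum_one show ?thesis
      using 4 assms
      by (auto simp: sum_subtractf basis_entry_def triangular_entry_def field_simps of_nat_diff)
  qed (use assms in \<open>auto simp: basis_entry_def triangular_entry_def of_nat_diff algebra_simps\<close>)
  ultimately show ?thesis by simp
qed

text \<open>Moves \<open>v\<close> to \<open>0\<close> and the leaf \<open>n\<close> to
  \<open>1\<close>: for \<open>v < n\<close> and \<open>n \<ge> 2\<close> the first swap fixes
  \<open>n\<close> and the second fixes \<open>0\<close>. This covers every choice of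
  \<open>v\<close> with one basis.\<close>

definition position :: "nat \<Rightarrow> nat \<Rightarrow> nat \<Rightarrow> nat" where
  "position n v = Transposition.transpose 1 n \<circ> Transposition.transpose 0 v"

lemma position_permutes:
  assumes "n \<ge> 2" "v < n"
  shows "position n v permutes {0..<Suc n}"
  unfolding position_def using assms
  by (intro permutes_compose permutes_swap_id) auto

lemma position_eq_iff:
  assumes "n \<ge> 2" "v < n"
  shows "position n v i = 0 \<longleftrightarrow> i = v" "position n v i = Suc 0 \<longleftrightarrow> i = n"
  using assms by (auto simp: position_def Transposition.transpose_def)

text \<open>Each neighbourhood is \<open>{v}\<close> or \<open>{0..n}\<close> with points removed.
  As \<open>position n v\<close> is injective and maps \<open>{0..n}\<close> onto itself, its image
  commutes with the removals.\<close>

lemma position_image_neighbours: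
  assumes n: "n \<ge> 2" and v: "v < n" and i: "i \<le> n"
  shows "position n v ` {k. {i, k} \<in> snd (G_graph n v)} =
    (if i = v then insert 1 {2..n} else if i = n then {0}
     else insert 0 {2..n} - {position n v i})"
proof -
  let ?s = "position n v"
  have inj: "inj ?s" using position_permutes[OF n v] by (rule permutes_inj)
  have all: "?s ` {0..n} = {0..n}"
    using permutes_image[OF position_permutes[OF n v]] by (simp add: atLeastLessThanSuc_atLeastAtMost)
  have sv: "?s v = 0" and sn: "?s n = 1" using position_eq_iff[OF n v] by auto
  have "{k. {i, k} \<in> snd (G_graph n v)} =
      (if i = v then {0..n} - {v} else if i = n then {v} else {0..n} - {n} - {i})"
    using i v by (auto simp: edge_G_graph_iff)
  moreover have "{0..n} - {0} = insert 1 {2..n}" "{0..n} - {1} = insert 0 {2..n}"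
    using n by auto
  ultimately show ?thesis
    by (simp add: image_set_diff[OF inj] all sv sn)
qed

lemma eigenvalue_mset_laplacian_G_graph:
  assumes n: "n \<ge> 2" and v: "v < n"
  shows "eigenvalue_mset (laplacian_mat (G_graph n v)) =
    {#0, 1#} + replicate_mset (n - 2) (real n) + {#real n + 1#}"
proof -
  let ?N = "Suc n" and ?s = "position n v" and ?L = "laplacian_mat (G_graph n v)"
  define Q where "Q = mat ?N ?N (\<lambda>(a, j). basis_entry n a j)"
  \<comment> \<open>The basis vectors with their coordinates carried back from positions to the
    original vertex numbers.\<close>
  define P where "P = mat ?N ?N (\<lambda>(i, j). Q $$ (?s i, j))"
  define T where "T = mat ?N ?N (\<lambda>(k, j). triangular_entry n k j)"
  have carrier: "Q \<in> carrier_mat ?N ?N" "P \<in> carrier_mat ?N ?N" "T \<in> carrier_mat ?N ?N"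
    by (auto simp: Q_def P_def T_def)
  have L: "?L \<in> carrier_mat ?N ?N"
    using fst_G_graph by (rule laplacian_mat_carrier)
  have perm: "?s permutes {0..<?N}" using position_permutes[OF n v] .
  have s_less: "?s i < ?N" if "i < ?N" for i
    using permutes_in_image[OF perm, of i] that by simp
  have P_index: "P $$ (i, j) = basis_entry n (?s i) j" if "i < ?N" "j < ?N" for i j
    using that s_less by (simp add: P_def Q_def)
  \<comment> \<open>The diagonal of \<open>Q\<close> is \<open>1, 1 - n, 1, ..., 1\<close>, nonzero
    as \<open>n \<ge> 2\<close>; permuting rows changes the determinant only by a sign.\<close>
  have "det Q = prod_list (diag_mat Q)"
    using carrier(1) by (rule det_lower_triangular[rotated]) (auto simp: Q_def basis_entry_def)
  also have "\<dots> \<noteq> 0"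
    using n by (auto simp: diag_mat_def prod_list_zero_iff Q_def basis_entry_def)
  finally have "det P \<noteq> 0"
    unfolding P_def det_permute_rows[OF carrier(1) perm] by (simp add: sign_def)
  moreover have "?L * P = P * T"
  proof (rule eq_matI)
    fix i j assume "i < dim_row (P * T)" "j < dim_col (P * T)"
    then have i: "i < ?N" and j: "j < ?N" using carrier by auto
    let ?A = "{k. {i, k} \<in> snd (G_graph n v)}"
    let ?f = "\<lambda>b. basis_entry n (?s i) j - basis_entry n b j"
    have inj: "inj_on ?s ?A" using permutes_inj[OF perm] by (rule inj_on_subset) simp
    have "(?L * P) $$ (i, j) = (\<Sum>k\<in>?A. P $$ (i, j) - P $$ (k, j))"
      using simple_graph_G_graph[OF v] fst_G_graph carrier(2) i j
      by (rule laplacian_mat_mult_index)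
    also have "\<dots> = (\<Sum>k\<in>?A. ?f (?s k))"
      using i j v by (intro sum.cong) (auto simp: P_index edge_G_graph_iff)
    also have "\<dots> = sum ?f (?s ` ?A)"
      using inj by (simp add: sum.reindex)
    \<comment> \<open>In the last case the position \<open>?s i\<close> joins the index set, with
      \<open>?f (?s i) = 0\<close>.\<close>
    also have "\<dots> = sum ?f (if ?s i = 0 then insert 1 {2..n} else if ?s i = 1 then {0}
        else insert 0 {2..n})"
      using i by (subst position_image_neighbours[OF n v])
        (auto simp: position_eq_iff[OF n v] sum_diff1 simp del: sum.insert)
    also have "\<dots> = (\<Sum>k = 0..<?N. basis_entry n (?s i) k * triangular_entry n k j)"
      using n s_less[OF i] j by (intro sum_basis_entry_triangular_entry[symmetric]) auto
    also have "\<dots> = (P * T) $$ (i, j)"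
      using carrier i j by (simp add: scalar_prod_def P_index T_def)
    finally show "(?L * P) $$ (i, j) = (P * T) $$ (i, j)" .
  qed (use L carrier in auto)
  ultimately have "similar_mat ?L T"
    using L carrier by (intro similar_mat_of_intertwining[of _ ?N _ P]) auto
  moreover have "upper_triangular T"
    by (auto simp: T_def upper_triangular_def triangular_entry_def)
  ultimately have "eigenvalue_mset ?L = mset (diag_mat T)"
    using carrier by (intro eigenvalue_mset_similar_upper_triangular)
  also have "diag_mat T = map (\<lambda>i. triangular_entry n i i) ([0, 1, 2] @ [3..<?N])"
  proof -
    \<comment> \<open>The tail has \<open>n + 1 - 3 = n - 2\<close> entries and is empty for
      \<open>n = 2\<close>.\<close>
    have "[0..<?N] = [0, 1, 2] @ [3..<?N]"
      using n upt_add_eq_append[of 0 3 "n - 2"] by (simp add: upt_rec)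
    moreover have "diag_mat T = map (\<lambda>i. triangular_entry n i i) [0..<?N]"
      by (auto simp: diag_mat_def T_def)
    ultimately show ?thesis by simp
  qed
  also have "\<dots> = [0, 1, real n + 1] @ map (\<lambda>_. real n) [3..<?N]"
    by (auto simp: triangular_entry_def)
  also have "map (\<lambda>_. real n) [3..<?N] = replicate (n - 2) (real n)"
    using n by (auto simp: map_replicate_const)
  finally show ?thesis by simp
qed

theorem lemma2:
  fixes n v :: nat
  assumes "n \<ge> 2" and "v < n"
  shows "eigenvalue_mset (laplacian_mat (G_graph n v)) =
           {#0, 1#} + replicate_mset (n - 2) (real n) + {#real n + 1#}
    \<and> lambda2 (G_graph n v) = 1
    \<and> gamma (G_graph n v) = real (card (snd (G_graph n v))) / lambda2 (G_graph n v)
    \<and> gamma (G_graph n v) = real (n choose 2) + 1"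
proof -
  note spectrum = eigenvalue_mset_laplacian_G_graph[OF assms]
  let ?xs = "[0, 1] @ replicate (n - 2) (real n) @ [real n + 1]"
  \<comment> \<open>Since \<open>1 \<le> n\<close>, the list is already in order, so index
    \<open>1\<close> reads off the eigenvalue \<open>1\<close>, even when the block of entries
    \<open>n\<close> is empty.\<close>
  have "sorted ?xs" using assms by (auto simp: sorted_append)
  then have "sorted_list_of_multiset (mset ?xs) = ?xs"
    by (simp only: sorted_list_of_multiset_mset sorted_sort_id)
  moreover have "eigenvalue_mset (laplacian_mat (G_graph n v)) = mset ?xs"
    using spectrum by simp
  ultimately have "lambda2 (G_graph n v) = 1"
    by (simp only: lambda2_def) simp
  with spectrum show ?thesis
    by (simp add: gamma_def card_edges_G_graph)
qed

end
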